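(* The Almkvist--Zudilin numbers $$Z(n)=\sum_{k=0}^{n}(-1)^k3^{n-3k}\binom{n}{3k}\binom{n+k}{n}\frac{(3k)!}{k!^3}\qquad(n\ge0)$$ satisfy $Z(n)\equiv1\pmod 8$ if $n$ is even and $Z(n)\equiv3\pmod8$ if $n$ is odd.
   Context: Terms with $3k>n$ vanish since $\binom{n}{3k}=0$ there. *)

theory Defs
  imports Complex_Main "HOL-Number_Theory.Cong"
begin

text \<open>
  The division is exact and the truncated exponent is harmless, since the binomial
  coefficient vanishes for \<open>3 * k > n\<close>; see \<open>almkvist_zudilin_rat\<close> below for the
  formula over the rationals.
\<close>

definition almkvist_zudilin :: "nat \<Rightarrow> int" where
  "almkvist_zudilin n =
     (\<Sum>k = 0..n. (-1) ^ k * 3 ^ (n - 3 * k) * int (n choose (3 * k)) * int ((n + k) choose n)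
        * (fact (3 * k) div fact k ^ 3))"

lemma fact_cube_dvd: "(fact k ^ 3 :: int) dvd fact (3 * k)"
proof -
  have "(fact k * fact k :: int) dvd fact (k + k)"
    by (rule fact_fact_dvd_fact)
  then have "(fact k * (fact k * fact k) :: int) dvd fact k * fact (k + k)"
    by (rule mult_dvd_mono[OF dvd_refl])
  also have "(fact k * fact (k + k) :: int) dvd fact (k + (k + k))"
    by (rule fact_fact_dvd_fact)
  finally show ?thesis
    by (simp add: power3_eq_cube mult.assoc numeral_3_eq_3)
qed

lemma almkvist_zudilin_rat:
  "(of_int (almkvist_zudilin n) :: rat) =
     (\<Sum>k = 0..n. (-1) ^ k * 3 powi (int n - 3 * int k) * of_nat (n choose (3 * k))
        * of_nat ((n + k) choose n) * (fact (3 * k) / fact k ^ 3))"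
proof -
  have quot: "(of_int (fact (3 * k) div fact k ^ 3) :: rat) = fact (3 * k) / fact k ^ 3" for k
    by (simp add: fact_cube_dvd of_int_div)
  have pow: "n < 3 * k \<or> (3::rat) ^ (n - 3 * k) = 3 powi (int n - 3 * int k)" for k
  proof (cases "n < 3 * k")
    case False
    then have "int n - 3 * int k = int (n - 3 * k)" by simp
    then show ?thesis by (simp only: power_int_of_nat simp_thms)
  qed simp
  show ?thesis
    unfolding almkvist_zudilin_def of_int_sum
    by (intro sum.cong refl) (simp add: quot pow)
qed

end

theory Submission imports Defs begin

text \<open>
  The product of the two binomial coefficients and the multinomial coefficient in the
  \<open>k\<close>-th term is \<open>(n+k)! / ((n-3k)! k!\<^sup>4) = C(n+k,4k) C(4k,2k) C(2k,k)\<^sup>2\<close>.  For \<open>k \<ge> 1\<close>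
  it contains three central binomial coefficients, each of which is even, so modulo \<open>8\<close> only
  the term \<open>3\<^sup>n\<close> for \<open>k = 0\<close> survives.
\<close>

text \<open>By Pascal's rule the coefficient is a sum of two neighbouring entries of row
  \<open>2 * m + 1\<close>, which are equal by symmetry.\<close>

lemma even_central_binomial:
  assumes "k > 0"
  shows "even ((2 * k) choose k)"
proof -
  obtain m where k: "k = Suc m" using assms by (cases k) auto
  have "(Suc (2 * m) choose m) = (Suc (2 * m) choose Suc m)"
    by (subst binomial_symmetric) auto
  then show ?thesis by (simp add: k)
qed

lemma almkvist_zudilin_coefficient:
  assumes "3 * k \<le> n"
  shows "int (n choose (3 * k)) * int ((n + k) choose n) * (fact (3 * k) div fact k ^ 3) =
    int ((n + k) choose (4 * k)) * (int ((4 * k) choose (2 * k)) * int ((2 * k) choose k) ^ 2)"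
    (is "?L = ?R")
proof -
  \<comment> \<open>Over the rationals \<open>div\<close> becomes true division and every binomial a
    quotient of factorials, so the identity is mere cancellation.\<close>
  have quot: "(of_int (fact (3 * k) div fact k ^ 3) :: rat) = fact (3 * k) / fact k ^ 3"
    by (simp add: fact_cube_dvd of_int_div)
  have "(of_nat (n choose (3 * k)) :: rat) = fact n / (fact (3 * k) * fact (n - 3 * k))"
    using assms by (rule binomial_fact)
  moreover have "(of_nat ((n + k) choose n) :: rat) = fact (n + k) / (fact n * fact k)"
    by (simp add: binomial_fact)
  moreover have "(of_nat ((n + k) choose (4 * k)) :: rat) =
      fact (n + k) / (fact (4 * k) * fact (n - 3 * k))"
  proof -
    have "n + k - 4 * k = n - 3 * k" by simp
    then show ?thesis using assms by (simp add: binomial_fact)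
  qed
  moreover have "(of_nat ((4 * k) choose (2 * k)) :: rat) =
      fact (4 * k) / (fact (2 * k) * fact (2 * k))"
    by (simp add: binomial_fact)
  moreover have "(of_nat ((2 * k) choose k) :: rat) = fact (2 * k) / (fact k * fact k)"
    by (simp add: binomial_fact)
  ultimately have "(of_int ?L :: rat) = of_int ?R"
    by (simp add: quot[unfolded power3_eq_cube] power2_eq_square power3_eq_cube)
  then show ?thesis by (simp only: of_int_eq_iff)
qed

lemma eight_dvd_almkvist_zudilin_term:
  assumes "k > 0"
  shows "8 dvd (-1) ^ k * 3 ^ (n - 3 * k) * int (n choose (3 * k)) * int ((n + k) choose n)
    * (fact (3 * k) div fact k ^ 3)"
proof (cases "3 * k \<le> n")
  case True
  have "even ((4 * k) choose (2 * k))"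
    using even_central_binomial[of "2 * k"] assms by simp
  \<comment> \<open>This is the 8: one factor 2 from the first binomial, two from the
    square.\<close>
  then have "2 * 2 ^ 2 dvd int ((4 * k) choose (2 * k)) * int ((2 * k) choose k) ^ 2"
    using even_central_binomial[OF assms] by (intro mult_dvd_mono dvd_power_same) simp_all
  then have "8 dvd int (n choose (3 * k)) * int ((n + k) choose n) * (fact (3 * k) div fact k ^ 3)"
    unfolding almkvist_zudilin_coefficient[OF True] by simp
  then show ?thesis
    by (simp only: mult.assoc dvd_mult)
qed (simp add: binomial_eq_0)

lemma almkvist_zudilin_cong_power_3: "[almkvist_zudilin n = 3 ^ n] (mod 8)"
  \<comment> \<open>Splitting off \<open>k = 0\<close> cancels \<open>3 ^ n\<close> and leaves only
    terms with \<open>k > 0\<close>.\<close>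
  unfolding almkvist_zudilin_def cong_iff_dvd_diff sum.atLeast_Suc_atMost[OF le0]
  using eight_dvd_almkvist_zudilin_term by (auto intro!: dvd_sum)

theorem theorem5p3:
  fixes n :: nat
  shows "(even n \<longrightarrow> [almkvist_zudilin n = 1] (mod 8)) \<and>
         (odd n \<longrightarrow> [almkvist_zudilin n = 3] (mod 8))"
proof -
  \<comment> \<open>Powers of 3 have period 2 modulo 8, as 9 is congruent to 1.\<close>
  have square: "[(3::int) ^ (2 * m) = 1] (mod 8)" for m
    using cong_pow[of "9::int" 1 8 m] by (simp add: power_mult cong_def)
  have "[(3::int) ^ (2 * m + 1) = 3] (mod 8)" for m
    using cong_scalar_left[OF square, of 3] by simp
  then show ?thesis
    using square cong_trans[OF almkvist_zudilin_cong_power_3] by (auto elim!: evenE oddE)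
qed

end
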